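(* Let $\mathcal H=\ell^2(\{\#\}\cup\mathbb Z)$, let $\xi\in\mathcal H$ be a unit vector, and let $\omega_\xi=\langle\,\cdot\,\xi,\xi\rangle$ be the associated pure state on the unital Boolean $C^*$-algebra $\mathfrak b=\mathcal K(\mathcal H)+\mathbb C I$, so that $\pi_{\omega_\xi}(\mathfrak b)''=\mathcal B(\mathcal H)$. Then the tail algebra of the associated Boolean process is $$\mathfrak Z^\perp_{\omega_\xi}=\mathbb C P_\#\oplus\mathbb C P_\#^\perp,$$ where $P_\#$ is the orthogonal projection onto $\mathbb C e_\#$. If moreover $0<|\langle e_\#,\xi\rangle|<1$, then there is no conditional expectation of $\mathcal B(\mathcal H)$ onto $\mathfrak Z^\perp_{\omega_\xi}$ which preserves the vector state $\langle\,\cdot\,\xi,\xi\rangle$.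
   Context: $\mathcal H=\ell^2(\{\#\}\cup\mathbb Z)$ has canonical orthonormal basis $\{e_\#\}\cup\{e_i\mid i\in\mathbb Z\}$ and is the Boolean Fock space $\mathbb C\oplus\ell^2(\mathbb Z)$ with vacuum $e_\#$. The Boolean annihilators are the rank-one operators $b_j=\langle\,\cdot\,,e_j\rangle e_\#$, with adjoints $b_j^\dagger=\langle\,\cdot\,,e_\#\rangle e_j$, $j\in\mathbb Z$ (inner product linear in the first argument); the unital $C^*$-algebra they generate is $\mathfrak b=\mathcal K(\mathcal H)+\mathbb C I$. The GNS representation of $\omega_\xi$ is identified with the identity representation of $\mathfrak b$ on $\mathcal H$ with cyclic vector $\xi$. The tail algebra is $$\mathfrak Z^\perp_{\omega_\xi}=\bigcap_{n\in\mathbb N}\{b_k,b_k^\dagger\mid k\in\mathbb Z,\ |k|>n\}'',$$ where $''$ is the bicommutant in $\mathcal B(\mathcal H)$. A conditional expectation of $\mathcal B(\mathcal H)$ onto a $C^*$-subalgebra is a norm-one linear projection onto it (not assumed normal); it preserves a state $\omega$ if $\omega\circ F=\omega$. *)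

theory Defs
  imports "HOL-Analysis.Analysis"
begin

section \<open>Complex normed spaces\<close>

class complex_normed_vector = real_normed_vector +
  fixes scaleC :: "complex \<Rightarrow> 'a \<Rightarrow> 'a"  (infixr \<open>*\<^sub>C\<close> 75)
  assumes scaleC_add_right: "c *\<^sub>C (x + y) = c *\<^sub>C x + c *\<^sub>C y"
    and scaleC_add_left: "(c + d) *\<^sub>C x = c *\<^sub>C x + d *\<^sub>C x"
    and scaleC_scaleC: "c *\<^sub>C d *\<^sub>C x = (c * d) *\<^sub>C x"
    and scaleR_scaleC: "r *\<^sub>R x = complex_of_real r *\<^sub>C x"
    and norm_scaleC: "norm (c *\<^sub>C x) = cmod c * norm x"

lemma scaleC_one [simp]: "1 *\<^sub>C x = (x :: 'a::complex_normed_vector)"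
  using scaleR_scaleC[of 1 x] by simp

lemma scaleC_zero_right [simp]: "c *\<^sub>C (0 :: 'a::complex_normed_vector) = 0"
  using norm_scaleC[of c "0 :: 'a"] by simp

lemma scaleC_minus_one: "(-1) *\<^sub>C x = - (x :: 'a::complex_normed_vector)"
  using scaleR_scaleC[of "-1" x] by simp

lemma scaleC_minus_right: "c *\<^sub>C (- x) = - (c *\<^sub>C (x :: 'a::complex_normed_vector))"
  by (metis scaleC_minus_one scaleC_scaleC mult.commute)

lemma scaleC_diff_right: "c *\<^sub>C (x - y) = c *\<^sub>C x - c *\<^sub>C (y :: 'a::complex_normed_vector)"
  using scaleC_add_right[of c x "- y"] by (simp add: scaleC_minus_right)

lemma bounded_linear_scaleC_right: "bounded_linear ((*\<^sub>C) c :: 'a \<Rightarrow> 'a::complex_normed_vector)"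
proof (rule bounded_linear_intro)
  fix x y :: 'a and r :: real
  show "c *\<^sub>C (x + y) = c *\<^sub>C x + c *\<^sub>C y" by (rule scaleC_add_right)
  show "c *\<^sub>C r *\<^sub>R x = r *\<^sub>R c *\<^sub>C x" by (simp add: scaleR_scaleC scaleC_scaleC mult.commute)
  show "norm (c *\<^sub>C x) \<le> norm x * cmod c" by (simp add: norm_scaleC)
qed

definition bounded_clinear ::
    "('a::complex_normed_vector \<Rightarrow> 'b::complex_normed_vector) \<Rightarrow> bool" where
  "bounded_clinear f \<longleftrightarrow> bounded_linear f \<and> (\<forall>c x. f (c *\<^sub>C x) = c *\<^sub>C f x)"


section \<open>The Hilbert space of square-summable families\<close>

typedef 'i ell2 = "{f :: 'i \<Rightarrow> complex. (\<lambda>i. (cmod (f i))\<^sup>2) summable_on UNIV}"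
  morphisms ell2_nth Abs_ell2
  by (rule exI[of _ "\<lambda>_. 0"]) simp

setup_lifting type_definition_ell2

lemma ell2_nth_summable: "(\<lambda>i. (cmod (ell2_nth x i))\<^sup>2) summable_on UNIV"
  using ell2_nth[of x] by simp

lemma ell2_eqI: "(\<And>i. ell2_nth x i = ell2_nth y i) \<Longrightarrow> x = y"
  by (simp add: ell2_nth_inject[symmetric] fun_eq_iff)

lemma cmod_mult_le_squares: "cmod (a * b) \<le> (cmod a)\<^sup>2 + (cmod b)\<^sup>2"
proof -
  have "0 \<le> (cmod a - cmod b)\<^sup>2" by simp
  then have "2 * (cmod a * cmod b) \<le> (cmod a)\<^sup>2 + (cmod b)\<^sup>2"
    by (simp add: power2_eq_square algebra_simps)
  moreover have "0 \<le> cmod a * cmod b" by simp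
  ultimately show ?thesis unfolding norm_mult by linarith
qed

lemma square_summable_add:
  assumes "(\<lambda>i. (cmod (f i))\<^sup>2) summable_on UNIV" "(\<lambda>i. (cmod (g i))\<^sup>2) summable_on UNIV"
  shows "(\<lambda>i. (cmod (f i + g i))\<^sup>2) summable_on UNIV"
proof (rule summable_on_comparison_test)
  show "(\<lambda>i. 2 * ((cmod (f i))\<^sup>2 + (cmod (g i))\<^sup>2)) summable_on UNIV"
    by (intro summable_on_cmult_right summable_on_add assms)
next
  fix i
  have "0 \<le> (cmod (f i) - cmod (g i))\<^sup>2" by simp
  then have "(cmod (f i) + cmod (g i))\<^sup>2 \<le> 2 * ((cmod (f i))\<^sup>2 + (cmod (g i))\<^sup>2)"
    by (simp add: power2_eq_square algebra_simps)
  moreover have "(cmod (f i + g i))\<^sup>2 \<le> (cmod (f i) + cmod (g i))\<^sup>2"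
    by (intro power_mono norm_triangle_ineq) simp
  ultimately show "(cmod (f i + g i))\<^sup>2 \<le> 2 * ((cmod (f i))\<^sup>2 + (cmod (g i))\<^sup>2)"
    by linarith
qed simp

lemma square_summable_scale:
  assumes "(\<lambda>i. (cmod (f i))\<^sup>2) summable_on UNIV"
  shows "(\<lambda>i. (cmod (c * f i))\<^sup>2) summable_on UNIV"
  using summable_on_cmult_right[OF assms, of "(cmod c)\<^sup>2"]
  by (simp add: norm_mult power_mult_distrib)

definition cinner :: "'i ell2 \<Rightarrow> 'i ell2 \<Rightarrow> complex" where
  "cinner x y = (\<Sum>\<^sub>\<infinity>i. ell2_nth x i * cnj (ell2_nth y i))"

lemma cinner_summable: "(\<lambda>i. ell2_nth x i * cnj (ell2_nth y i)) summable_on UNIV"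
proof (rule abs_summable_summable)
  show "(\<lambda>i. norm (ell2_nth x i * cnj (ell2_nth y i))) summable_on UNIV"
  proof (rule summable_on_comparison_test)
    show "(\<lambda>i. (cmod (ell2_nth x i))\<^sup>2 + (cmod (ell2_nth y i))\<^sup>2) summable_on UNIV"
      by (intro summable_on_add ell2_nth_summable)
  next
    fix i
    show "norm (ell2_nth x i * cnj (ell2_nth y i))
        \<le> (cmod (ell2_nth x i))\<^sup>2 + (cmod (ell2_nth y i))\<^sup>2"
      using cmod_mult_le_squares[of "ell2_nth x i" "cnj (ell2_nth y i)"] by simp
  qed simp
qed

instantiation ell2 :: (type) real_inner
begin

lift_definition zero_ell2 :: "'a ell2" is "\<lambda>_. 0" by simp

lift_definition plus_ell2 :: "'a ell2 \<Rightarrow> 'a ell2 \<Rightarrow> 'a ell2" is "\<lambda>f g i. f i + g i"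
  by (rule square_summable_add)

lift_definition uminus_ell2 :: "'a ell2 \<Rightarrow> 'a ell2" is "\<lambda>f i. - f i" by simp

lift_definition minus_ell2 :: "'a ell2 \<Rightarrow> 'a ell2 \<Rightarrow> 'a ell2" is "\<lambda>f g i. f i - g i"
  using square_summable_add[of _ "\<lambda>i. - _ i"] by simp

lift_definition scaleR_ell2 :: "real \<Rightarrow> 'a ell2 \<Rightarrow> 'a ell2" is "\<lambda>r f i. complex_of_real r * f i"
  by (rule square_summable_scale)

definition inner_ell2 :: "'a ell2 \<Rightarrow> 'a ell2 \<Rightarrow> real" where
  "inner_ell2 x y = Re (cinner x y)"

definition norm_ell2 :: "'a ell2 \<Rightarrow> real" where
  "norm_ell2 x = sqrt (\<Sum>\<^sub>\<infinity>i. (cmod (ell2_nth x i))\<^sup>2)"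

definition dist_ell2 :: "'a ell2 \<Rightarrow> 'a ell2 \<Rightarrow> real" where
  "dist_ell2 x y = norm (x - y)"

definition sgn_ell2 :: "'a ell2 \<Rightarrow> 'a ell2" where
  "sgn_ell2 x = inverse (norm x) *\<^sub>R x"

definition uniformity_ell2 :: "('a ell2 \<times> 'a ell2) filter" where
  "uniformity_ell2 = (INF e\<in>{0<..}. principal {(x, y). dist x y < e})"

definition open_ell2 :: "'a ell2 set \<Rightarrow> bool" where
  "open_ell2 U = (\<forall>x\<in>U. \<forall>\<^sub>F (x', y) in uniformity. x' = x \<longrightarrow> y \<in> U)"

instance
proof
  fix x y z :: "'a ell2" and r s :: real
  show "x + y + z = x + (y + z)" "x + y = y + x" "0 + x = x" "- x + x = 0" "x - y = x + - y"
    by (transfer; simp add: algebra_simps)+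
  show "r *\<^sub>R (x + y) = r *\<^sub>R x + r *\<^sub>R y" "(r + s) *\<^sub>R x = r *\<^sub>R x + s *\<^sub>R x"
    "r *\<^sub>R s *\<^sub>R x = (r * s) *\<^sub>R x" "1 *\<^sub>R x = x"
    by (transfer; simp add: algebra_simps)+
  show "sgn x = inverse (norm x) *\<^sub>R x" by (rule sgn_ell2_def)
  show "dist x y = norm (x - y)" by (rule dist_ell2_def)
  show "(uniformity :: ('a ell2 \<times> 'a ell2) filter)
      = (INF e\<in>{0<..}. principal {(x, y). dist x y < e})"
    by (rule uniformity_ell2_def)
  show "open U = (\<forall>x\<in>U. \<forall>\<^sub>F (x', y) in uniformity. x' = x \<longrightarrow> y \<in> U)" for U :: "'a ell2 set"
    by (rule open_ell2_def)
  have self: "inner x x = (\<Sum>\<^sub>\<infinity>i. (cmod (ell2_nth x i))\<^sup>2)" for x :: "'a ell2"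
  proof -
    have "Re (cinner x x) = (\<Sum>\<^sub>\<infinity>i. Re (ell2_nth x i * cnj (ell2_nth x i)))"
      unfolding cinner_def by (rule infsum_Re[OF cinner_summable, symmetric])
    moreover have "Re (z * cnj z) = (cmod z)\<^sup>2" for z
      unfolding cmod_power2 by (simp add: power2_eq_square)
    ultimately show ?thesis
      by (simp only: inner_ell2_def)
  qed
  have "cinner y x = cnj (cinner x y)"
    unfolding cinner_def infsum_cnj[symmetric] by (simp add: mult.commute)
  then show "inner x y = inner y x"
    by (simp add: inner_ell2_def)
  have "cinner (x + y) z = cinner x z + cinner y z"
    unfolding cinner_def by (simp add: plus_ell2.rep_eq distrib_right infsum_add cinner_summable)
  then show "inner (x + y) z = inner x z + inner y z"
    by (simp add: inner_ell2_def)
  have "cinner (r *\<^sub>R x) y = complex_of_real r * cinner x y"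
    unfolding cinner_def by (simp add: scaleR_ell2.rep_eq mult.assoc infsum_cmult_right')
  then show "inner (r *\<^sub>R x) y = r * inner x y"
    by (simp add: inner_ell2_def)
  show "0 \<le> inner x x"
    unfolding self by (rule infsum_nonneg) simp
  show "norm x = sqrt (inner x x)"
    unfolding self by (rule norm_ell2_def)
  show "inner x x = 0 \<longleftrightarrow> x = 0"
  proof
    assume "inner x x = 0"
    then have "(cmod (ell2_nth x i))\<^sup>2 = 0" for i
      by (intro nonneg_infsum_le_0D[where A = UNIV and f = "\<lambda>i. (cmod (ell2_nth x i))\<^sup>2"])
        (auto simp: self ell2_nth_summable)
    then show "x = 0"
      by (intro ell2_eqI) (simp add: zero_ell2.rep_eq)
  next
    assume "x = 0"
    then show "inner x x = 0"
      by (simp add: self zero_ell2.rep_eq)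
  qed
qed

end

instantiation ell2 :: (type) complex_normed_vector
begin

lift_definition scaleC_ell2 :: "complex \<Rightarrow> 'a ell2 \<Rightarrow> 'a ell2" is "\<lambda>c f i. c * f i"
  by (rule square_summable_scale)

instance
proof
  fix x y :: "'a ell2" and c d :: complex and r :: real
  show "c *\<^sub>C (x + y) = c *\<^sub>C x + c *\<^sub>C y" "(c + d) *\<^sub>C x = c *\<^sub>C x + d *\<^sub>C x"
    "c *\<^sub>C d *\<^sub>C x = (c * d) *\<^sub>C x" "r *\<^sub>R x = complex_of_real r *\<^sub>C x"
    by (transfer; simp add: algebra_simps)+
  show "norm (c *\<^sub>C x) = cmod c * norm x"
    by (simp add: norm_ell2_def scaleC_ell2.rep_eq norm_mult power_mult_distrib
        infsum_cmult_right' real_sqrt_mult)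
qed

end

lemma cinner_add_left: "cinner (x + y) z = cinner x z + cinner y z"
  unfolding cinner_def by (simp add: plus_ell2.rep_eq distrib_right infsum_add cinner_summable)

lemma cinner_scaleC_left: "cinner (c *\<^sub>C x) y = c * cinner x y"
  unfolding cinner_def by (simp add: scaleC_ell2.rep_eq mult.assoc infsum_cmult_right')

lemma cinner_commute: "cinner y x = cnj (cinner x y)"
  unfolding cinner_def infsum_cnj[symmetric] by (simp add: mult.commute)

lemma cinner_scaleC_right: "cinner x (c *\<^sub>C y) = cnj c * cinner x y"
  by (metis cinner_commute cinner_scaleC_left complex_cnj_mult)

lemma cinner_self: "cinner x x = complex_of_real ((norm x)\<^sup>2)"
proof (rule complex_eqI)
  show "Re (cinner x x) = Re (complex_of_real ((norm x)\<^sup>2))"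
    using power2_norm_eq_inner[of x] by (simp add: inner_ell2_def)
  show "Im (cinner x x) = Im (complex_of_real ((norm x)\<^sup>2))"
    using arg_cong[OF cinner_commute[of x x], of Im] by simp
qed

lemma cinner_Cauchy_Schwarz: "cmod (cinner x y) \<le> norm x * norm y"
proof (cases "cinner x y = 0")
  case False
  define c where "c = cnj (cinner x y) / cmod (cinner x y)"
  have c: "cmod c = 1"
    using False by (simp add: c_def norm_divide)
  have "complex_of_real (cmod (cinner x y)) = cinner (c *\<^sub>C x) y"
    using False
    by (simp add: cinner_scaleC_left c_def complex_norm_square[symmetric] power2_eq_square
        mult.commute[of "cnj _"])
  then have "cmod (cinner x y) = inner (c *\<^sub>C x) y"
    by (metis Re_complex_of_real inner_ell2_def)
  also have "\<dots> \<le> norm (c *\<^sub>C x) * norm y"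
    by (rule norm_cauchy_schwarz)
  finally show ?thesis by (simp add: norm_scaleC c)
qed simp

lift_definition basis_vec :: "'i \<Rightarrow> 'i ell2" is "\<lambda>j i. if i = j then 1 else 0"
proof -
  fix j :: 'i
  have "(\<lambda>i. (cmod (if i = j then 1 else 0))\<^sup>2) summable_on {j}" by simp
  then show "(\<lambda>i. (cmod (if i = j then 1 else 0))\<^sup>2) summable_on UNIV"
    by (rule summable_on_cong_neutral[THEN iffD1, rotated -1]) auto
qed

lemma cinner_basis_vec_right: "cinner x (basis_vec j) = ell2_nth x j"
proof -
  have "cinner x (basis_vec j) = (\<Sum>\<^sub>\<infinity>i\<in>{j}. ell2_nth x i)"
    unfolding cinner_def by (rule infsum_cong_neutral) (auto simp: basis_vec.rep_eq)
  then show ?thesis by simp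
qed

lemma norm_basis_vec [simp]: "norm (basis_vec j) = 1"
proof -
  have "complex_of_real ((norm (basis_vec j))\<^sup>2) = 1"
    unfolding cinner_self[symmetric] cinner_basis_vec_right by (simp add: basis_vec.rep_eq)
  then have "(norm (basis_vec j))\<^sup>2 = 1"
    by (metis of_real_eq_1_iff)
  then show ?thesis
    using norm_ge_zero[of "basis_vec j"] by (simp add: power2_eq_1_iff)
qed


section \<open>The algebra of bounded complex-linear operators\<close>

text \<open>The type \<open>'i ell2_op\<close> is \<open>B(\<ell>\<^sup>2('i))\<close>; the library's \<open>\<Rightarrow>\<^sub>L\<close> only asks for real linearity.\<close>

typedef 'i ell2_op = "{T :: 'i ell2 \<Rightarrow>\<^sub>L 'i ell2. bounded_clinear (blinfun_apply T)}"
  morphisms blinfun_of_op Abs_ell2_op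
  by (rule exI[of _ 0]) (simp add: bounded_clinear_def blinfun.bounded_linear_right)

lifting_forget ell2.lifting
lifting_forget blinfun.lifting

setup_lifting type_definition_ell2_op

lift_definition op_apply :: "'i ell2_op \<Rightarrow> 'i ell2 \<Rightarrow> 'i ell2"  (infixr \<open>\<bullet>\<^sub>v\<close> 70)
  is blinfun_apply .

lemma ell2_op_eqI: "(\<And>x. S \<bullet>\<^sub>v x = T \<bullet>\<^sub>v x) \<Longrightarrow> S = T"
  by transfer (rule blinfun_eqI)

instantiation ell2_op :: (type) real_normed_algebra_1
begin

lift_definition zero_ell2_op :: "'a ell2_op" is 0
  by (simp add: bounded_clinear_def blinfun.bounded_linear_right)

lift_definition one_ell2_op :: "'a ell2_op" is id_blinfun
  by (simp add: bounded_clinear_def)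

lift_definition plus_ell2_op :: "'a ell2_op \<Rightarrow> 'a ell2_op \<Rightarrow> 'a ell2_op" is "(+)"
  by (simp add: bounded_clinear_def plus_blinfun.rep_eq scaleC_add_right bounded_linear_add)

lift_definition uminus_ell2_op :: "'a ell2_op \<Rightarrow> 'a ell2_op" is uminus
  by (simp add: bounded_clinear_def uminus_blinfun.rep_eq scaleC_minus_right bounded_linear_minus)

lift_definition minus_ell2_op :: "'a ell2_op \<Rightarrow> 'a ell2_op \<Rightarrow> 'a ell2_op" is "(-)"
  by (simp add: bounded_clinear_def minus_blinfun.rep_eq scaleC_diff_right bounded_linear_sub)

lift_definition times_ell2_op :: "'a ell2_op \<Rightarrow> 'a ell2_op \<Rightarrow> 'a ell2_op" is "(o\<^sub>L)"
  by (simp add: bounded_clinear_def blinfun.bounded_linear_right)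

lift_definition scaleR_ell2_op :: "real \<Rightarrow> 'a ell2_op \<Rightarrow> 'a ell2_op" is "(*\<^sub>R)"
  by (simp add: bounded_clinear_def blinfun.bounded_linear_right)
    (simp add: scaleR_blinfun.rep_eq scaleR_scaleC scaleC_scaleC mult.commute)

lift_definition norm_ell2_op :: "'a ell2_op \<Rightarrow> real" is norm .

definition dist_ell2_op :: "'a ell2_op \<Rightarrow> 'a ell2_op \<Rightarrow> real" where
  "dist_ell2_op S T = norm (S - T)"

definition sgn_ell2_op :: "'a ell2_op \<Rightarrow> 'a ell2_op" where
  "sgn_ell2_op T = inverse (norm T) *\<^sub>R T"

definition uniformity_ell2_op :: "('a ell2_op \<times> 'a ell2_op) filter" where
  "uniformity_ell2_op = (INF e\<in>{0<..}. principal {(x, y). dist x y < e})"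

definition open_ell2_op :: "'a ell2_op set \<Rightarrow> bool" where
  "open_ell2_op U = (\<forall>x\<in>U. \<forall>\<^sub>F (x', y) in uniformity. x' = x \<longrightarrow> y \<in> U)"

instance
proof
  fix R S T :: "'a ell2_op" and r s :: real
  show "R + S + T = R + (S + T)" "R + S = S + R" "0 + R = R" "- R + R = 0" "R - S = R + - S"
    by (transfer; simp add: algebra_simps)+
  show "r *\<^sub>R (S + T) = r *\<^sub>R S + r *\<^sub>R T" "(r + s) *\<^sub>R T = r *\<^sub>R T + s *\<^sub>R T"
    "r *\<^sub>R s *\<^sub>R T = (r * s) *\<^sub>R T" "1 *\<^sub>R T = T"
    by (transfer; simp add: algebra_simps)+
  show "R * S * T = R * (S * T)" "1 * T = T" "T * 1 = T"
    "(R + S) * T = R * T + S * T" "R * (S + T) = R * S + R * T"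
    "r *\<^sub>R S * T = r *\<^sub>R (S * T)" "S * r *\<^sub>R T = r *\<^sub>R (S * T)"
    by (transfer; rule blinfun_eqI;
        simp add: blinfun.add_left blinfun.add_right blinfun.scaleR_left blinfun.scaleR_right)+
  show norm_one: "norm (1 :: 'a ell2_op) = 1"
  proof transfer
    have "norm (id_blinfun :: 'a ell2 \<Rightarrow>\<^sub>L 'a ell2) \<le> 1"
      by (rule norm_blinfun_bound) simp_all
    moreover have "norm (id_blinfun :: 'a ell2 \<Rightarrow>\<^sub>L 'a ell2) \<ge> 1"
      using norm_blinfun[of "id_blinfun :: 'a ell2 \<Rightarrow>\<^sub>L 'a ell2" "basis_vec undefined"] by simp
    ultimately show "norm (id_blinfun :: 'a ell2 \<Rightarrow>\<^sub>L 'a ell2) = 1" by simp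
  qed
  have "norm (0 :: 'a ell2_op) = 0" by transfer simp
  with norm_one show "(0 :: 'a ell2_op) \<noteq> 1" by auto
  show "norm T = 0 \<longleftrightarrow> T = 0" "norm (r *\<^sub>R T) = \<bar>r\<bar> * norm T"
    by (transfer; simp)+
  show "norm (S + T) \<le> norm S + norm T"
    by transfer (rule norm_triangle_ineq)
  show "norm (S * T) \<le> norm S * norm T"
    by transfer (rule norm_blinfun_compose)
  show "sgn T = inverse (norm T) *\<^sub>R T" by (rule sgn_ell2_op_def)
  show "dist S T = norm (S - T)" by (rule dist_ell2_op_def)
  show "(uniformity :: ('a ell2_op \<times> 'a ell2_op) filter)
      = (INF e\<in>{0<..}. principal {(x, y). dist x y < e})"
    by (rule uniformity_ell2_op_def)
  show "open U = (\<forall>x\<in>U. \<forall>\<^sub>F (x', y) in uniformity. x' = x \<longrightarrow> y \<in> U)"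
    for U :: "'a ell2_op set"
    by (rule open_ell2_op_def)
qed

end

lemma onorm_scaleC:
  assumes "bounded_linear f"
  shows "onorm (\<lambda>x. c *\<^sub>C f x) = cmod c * onorm (f :: _ \<Rightarrow> _::complex_normed_vector)"
proof -
  have le: "onorm (\<lambda>x. c *\<^sub>C f x) \<le> cmod c * onorm f"
    if "bounded_linear f" for c and f :: "'a \<Rightarrow> 'b"
  proof (rule onorm_bound)
    show "norm (c *\<^sub>C f x) \<le> cmod c * onorm f * norm x" for x
      using onorm[OF that, of x] by (simp add: norm_scaleC mult.assoc mult_left_mono)
  qed (simp add: onorm_pos_le that)
  show ?thesis
  proof (cases "c = 0")
    case True
    then show ?thesis
      using le[OF assms, of 0] onorm_pos_le[of "\<lambda>x. c *\<^sub>C f x"]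
        bounded_linear_compose[OF bounded_linear_scaleC_right assms, of c] by simp
  next
    case False
    have "f = (\<lambda>x. inverse c *\<^sub>C c *\<^sub>C f x)"
      using False by (simp add: scaleC_scaleC)
    then have "onorm f \<le> cmod (inverse c) * onorm (\<lambda>x. c *\<^sub>C f x)"
      using le[OF bounded_linear_compose[OF bounded_linear_scaleC_right assms], of "inverse c" c]
      by simp
    then have "cmod c * onorm f \<le> onorm (\<lambda>x. c *\<^sub>C f x)"
      using False by (simp only: norm_inverse) (simp add: divide_simps mult.commute)
    with le[OF assms, of c] show ?thesis by simp
  qed
qed

lemma op_apply_simps [simp]:
  "0 \<bullet>\<^sub>v x = 0" "1 \<bullet>\<^sub>v x = x"
  "(S + T) \<bullet>\<^sub>v x = S \<bullet>\<^sub>v x + T \<bullet>\<^sub>v x" "(S - T) \<bullet>\<^sub>v x = S \<bullet>\<^sub>v x - T \<bullet>\<^sub>v x" "(- T) \<bullet>\<^sub>v x = - (T \<bullet>\<^sub>v x)"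
  "(S * T) \<bullet>\<^sub>v x = S \<bullet>\<^sub>v T \<bullet>\<^sub>v x" "(r *\<^sub>R T) \<bullet>\<^sub>v x = r *\<^sub>R (T \<bullet>\<^sub>v x)"
  by (transfer; simp add: blinfun.add_left blinfun.diff_left blinfun.minus_left
      blinfun.scaleR_left)+

lemma norm_op_eq_onorm: "norm T = onorm (op_apply T)"
  by transfer (simp add: norm_blinfun.rep_eq)

lemma bounded_linear_op_apply: "bounded_linear (op_apply T)"
  by transfer (rule blinfun.bounded_linear_right)

instantiation ell2_op :: (type) complex_normed_vector
begin

lift_definition scaleC_ell2_op :: "complex \<Rightarrow> 'a ell2_op \<Rightarrow> 'a ell2_op"
  is "\<lambda>c T. Blinfun (\<lambda>x. c *\<^sub>C blinfun_apply T x)"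
  by (simp add: bounded_clinear_def bounded_linear_Blinfun_apply scaleC_scaleC mult.commute
      bounded_linear_compose[OF bounded_linear_scaleC_right blinfun.bounded_linear_right])

lemma op_apply_scaleC [simp]: "(c *\<^sub>C T) \<bullet>\<^sub>v x = c *\<^sub>C (T \<bullet>\<^sub>v x)"
  by transfer (subst bounded_linear_Blinfun_apply[OF
      bounded_linear_compose[OF bounded_linear_scaleC_right blinfun.bounded_linear_right]], rule refl)

instance
proof
  fix S T :: "'a ell2_op" and c d :: complex and r :: real
  show "c *\<^sub>C (S + T) = c *\<^sub>C S + c *\<^sub>C T"
    by (rule ell2_op_eqI) (simp add: scaleC_add_right)
  show "(c + d) *\<^sub>C T = c *\<^sub>C T + d *\<^sub>C T"
    by (rule ell2_op_eqI) (simp add: scaleC_add_left)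
  show "c *\<^sub>C d *\<^sub>C T = (c * d) *\<^sub>C T"
    by (rule ell2_op_eqI) (simp add: scaleC_scaleC)
  show "r *\<^sub>R T = complex_of_real r *\<^sub>C T"
    by (rule ell2_op_eqI) (simp add: scaleR_scaleC)
  show "norm (c *\<^sub>C T) = cmod c * norm T"
    unfolding norm_op_eq_onorm onorm_scaleC[OF bounded_linear_op_apply, symmetric]
    by (rule arg_cong[where f = onorm]) (rule ext, rule op_apply_scaleC)
qed

end

definition commutant :: "'i ell2_op set \<Rightarrow> 'i ell2_op set" where
  "commutant M = {T. \<forall>S\<in>M. T * S = S * T}"

definition bicommutant :: "'i ell2_op set \<Rightarrow> 'i ell2_op set" where
  "bicommutant M = commutant (commutant M)"

definition compact_op :: "'i ell2_op \<Rightarrow> bool" where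
  "compact_op T \<longleftrightarrow> compact (closure (op_apply T ` cball 0 1))"

text \<open>\<open>rank_one u v\<close> is the operator \<open>\<langle>\<cdot>, v\<rangle> u\<close>.\<close>

lemma bounded_linear_rank_one:
  fixes u v :: "'i ell2"
  shows "bounded_linear (\<lambda>x. cinner x v *\<^sub>C u)"
proof (rule bounded_linear_intro)
  fix x y :: "'i ell2" and r :: real
  show "cinner (x + y) v *\<^sub>C u = cinner x v *\<^sub>C u + cinner y v *\<^sub>C u"
    by (simp add: cinner_add_left scaleC_add_left)
  show "cinner (r *\<^sub>R x) v *\<^sub>C u = r *\<^sub>R cinner x v *\<^sub>C u"
    by (simp add: scaleR_scaleC cinner_scaleC_left scaleC_scaleC)
  show "norm (cinner x v *\<^sub>C u) \<le> norm x * (norm v * norm u)"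
    using cinner_Cauchy_Schwarz[of x v]
    by (simp add: norm_scaleC mult.assoc[symmetric] mult_right_mono)
qed

lift_definition rank_one :: "'i ell2 \<Rightarrow> 'i ell2 \<Rightarrow> 'i ell2_op"
  is "\<lambda>u v. Blinfun (\<lambda>x. cinner x v *\<^sub>C u)"
  by (simp add: bounded_clinear_def bounded_linear_Blinfun_apply bounded_linear_rank_one
      cinner_scaleC_left scaleC_scaleC)

lemma rank_one_apply: "rank_one u v \<bullet>\<^sub>v x = cinner x v *\<^sub>C u"
  by transfer (simp add: bounded_linear_Blinfun_apply bounded_linear_rank_one)

lemma compact_rank_one: "compact_op (rank_one u v)"
proof -
  let ?L = "\<lambda>c. c *\<^sub>C u"
  have "bounded_linear ?L"
    by (rule bounded_linear_intro[where K = "norm u"])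
      (simp_all add: scaleC_add_left scaleR_scaleC scaleC_scaleC scaleR_conv_of_real norm_scaleC)
  then have "compact (?L ` cball 0 (norm v))"
    by (intro compact_continuous_image linear_continuous_on compact_cball)
  moreover have "op_apply (rank_one u v) ` cball 0 1 \<subseteq> ?L ` cball 0 (norm v)"
  proof (rule image_subsetI)
    fix x :: "'a ell2" assume "x \<in> cball 0 1"
    then have "cmod (cinner x v) \<le> norm v"
      using cinner_Cauchy_Schwarz[of x v] mult_right_mono[of "norm x" 1 "norm v"] by simp
    then show "rank_one u v \<bullet>\<^sub>v x \<in> ?L ` cball 0 (norm v)"
      by (simp add: rank_one_apply)
  qed
  ultimately show ?thesis
    unfolding compact_op_def
    by (metis closed_Int_compact closed_closure closure_minimal compact_imp_closed inf.orderE)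
qed

definition vector_state :: "'i ell2 \<Rightarrow> 'i ell2_op \<Rightarrow> complex" where
  "vector_state \<xi> T = cinner (T \<bullet>\<^sub>v \<xi>) \<xi>"

definition conditional_expectation_onto ::
    "'i ell2_op set \<Rightarrow> ('i ell2_op \<Rightarrow> 'i ell2_op) \<Rightarrow> bool" where
  "conditional_expectation_onto A F \<longleftrightarrow>
     bounded_clinear F \<and> onorm F = 1 \<and> F \<circ> F = F \<and> range F = A"

definition preserves_state ::
    "('i ell2_op \<Rightarrow> complex) \<Rightarrow> ('i ell2_op \<Rightarrow> 'i ell2_op) \<Rightarrow> bool" where
  "preserves_state \<omega> F \<longleftrightarrow> \<omega> \<circ> F = \<omega>"


section \<open>The Boolean process\<close>

text \<open>The index set \<open>{#} \<union> \<int>\<close> is \<open>int option\<close>, with \<open>#\<close> encoded as \<open>None\<close>.\<close>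

type_synonym boolean_fock = "int option ell2"

definition vacuum :: boolean_fock where
  "vacuum = basis_vec None"

definition annihilator :: "int \<Rightarrow> int option ell2_op" where
  "annihilator j = rank_one vacuum (basis_vec (Some j))"

definition creator :: "int \<Rightarrow> int option ell2_op" where
  "creator j = rank_one (basis_vec (Some j)) vacuum"

lemma creator_is_adjoint: "cinner (annihilator j \<bullet>\<^sub>v x) y = cinner x (creator j \<bullet>\<^sub>v y)"
  by (simp add: annihilator_def creator_def rank_one_apply cinner_scaleC_left cinner_scaleC_right
      cinner_commute[of y vacuum])

definition vacuum_proj :: "int option ell2_op" where
  "vacuum_proj = rank_one vacuum vacuum"

definition boolean_algebra :: "int option ell2_op set" where
  "boolean_algebra = {K + c *\<^sub>C 1 | K c. compact_op K}"

lemma boolean_algebra_cyclic: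
  assumes "norm \<xi> = 1"
  shows "(\<lambda>T. T \<bullet>\<^sub>v \<xi>) ` boolean_algebra = UNIV"
proof -
  have "\<eta> \<in> (\<lambda>T. T \<bullet>\<^sub>v \<xi>) ` boolean_algebra" for \<eta>
  proof (rule image_eqI)
    show "\<eta> = (rank_one \<eta> \<xi> + 0 *\<^sub>C 1) \<bullet>\<^sub>v \<xi>"
      using assms scaleR_scaleC[of 0 \<xi>] by (simp add: rank_one_apply cinner_self)
    show "rank_one \<eta> \<xi> + 0 *\<^sub>C 1 \<in> boolean_algebra"
      unfolding boolean_algebra_def using compact_rank_one by blast
  qed
  then show ?thesis by blast
qed

text \<open>The tail algebra in the GNS representation of \<open>vector_state \<xi>\<close>, which is the identity
  representation of \<open>boolean_algebra\<close> with the cyclic vector \<open>\<xi>\<close> (\<open>boolean_algebra_cyclic\<close>);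
  hence no dependence on \<open>\<xi>\<close>.\<close>

definition tail_algebra :: "int option ell2_op set" where
  "tail_algebra =
     (\<Inter>n::nat. bicommutant (\<Union>k\<in>{k. \<bar>k\<bar> > int n}. {annihilator k, creator k}))"

end

theory Submission
  imports Defs
begin

text \<open>
  Write \<open>P\<close> for \<open>vacuum_proj\<close>, \<open>Q = 1 - P\<close>, \<open>e\<^sub>i\<close> for the basis vectors and \<open>b\<^sub>j\<close> for the
  annihilators.

  The Boolean algebra contains every rank-one operator, and only scalars commute with all of
  these; this gives the bicommutant.

  The tail algebra contains \<open>P\<close> because \<open>P = b\<^sub>k b\<^sub>k\<^sup>\<dagger>\<close> for every \<open>k\<close>, however large. Conversely,
  the matrix unit \<open>\<langle>\<cdot>, e\<^sub>j\<rangle> e\<^sub>i\<close> with \<open>i, j \<in> \<int>\<close> commutes with all generators of index beyond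
  \<open>\<bar>i\<bar>\<close> and \<open>\<bar>j\<bar>\<close> (all products vanish), so it commutes with the tail algebra. An operator that
  commutes with all these matrix units acts on the \<open>e\<^sub>i\<close>, \<open>i \<in> \<int>\<close>, by one common scalar and maps the
  vacuum to a multiple of itself (\<open>tail_algebra_diagonal\<close>). That determines the operator, by
  boundedness and the convergence of the basis expansion (\<open>ell2_op_eqI_basis\<close>).

  A conditional expectation \<open>F\<close> onto \<open>\<complex>P \<oplus> \<complex>Q\<close> must annihilate every \<open>b\<^sub>j\<close>
  (\<open>expectation_annihilator_eq_zero\<close>). This is the off-diagonal part of Tomiyama's theorem that
  norm-one projections are bimodule maps, and its proof specialises as follows. If
  \<open>F b\<^sub>j = aP + bQ\<close>, then for real \<open>s \<ge> 0\<close> the operator \<open>F (b\<^sub>j + saP) = (1 + s)aP + bQ\<close> has norm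
  at least \<open>(1 + s)\<bar>a\<bar>\<close>, whereas \<open>b\<^sub>j + saP\<close> has norm at most \<open>sqrt (1 + s\<^sup>2\<bar>a\<bar>\<^sup>2)\<close> because \<open>b\<^sub>j\<close> and
  \<open>P\<close> have orthogonal supports. As \<open>F\<close> is contractive, letting \<open>s\<close> grow forces \<open>a = 0\<close>. Adding \<open>sbQ\<close>
  instead, where orthogonality of the ranges takes over, forces \<open>b = 0\<close>.

  If \<open>F\<close> preserved the vector state of \<open>\<xi>\<close>, the state would therefore vanish on every \<open>b\<^sub>j\<close>. Its
  value there is the product of the \<open>j\<close>-th coordinate of \<open>\<xi>\<close> with \<open>\<langle>e\<^sub>#, \<xi>\<rangle>\<close>. The second
  factor is nonzero by assumption, and \<open>\<bar>\<langle>e\<^sub>#, \<xi>\<rangle>\<bar> < 1\<close> makes the first one nonzero for some \<open>j\<close>.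
\<close>

section \<open>Coordinates and the basis expansion\<close>

lemma ell2_nth_simps [simp]:
  "ell2_nth 0 i = 0"
  "ell2_nth (x + y) i = ell2_nth x i + ell2_nth y i"
  "ell2_nth (x - y) i = ell2_nth x i - ell2_nth y i"
  "ell2_nth (- x) i = - ell2_nth x i"
  "ell2_nth (c *\<^sub>C x) i = c * ell2_nth x i"
  "ell2_nth (basis_vec j) i = (if i = j then 1 else 0)"
  by (simp_all add: zero_ell2.rep_eq plus_ell2.rep_eq minus_ell2.rep_eq uminus_ell2.rep_eq
      scaleC_ell2.rep_eq basis_vec.rep_eq)

lemma ell2_nth_sum: "ell2_nth (sum f F) i = (\<Sum>j\<in>F. ell2_nth (f j) i)"
  by (induction F rule: infinite_finite_induct) simp_all

lemma cinner_basis_vec_left: "cinner (basis_vec j) x = cnj (ell2_nth x j)"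
  by (metis cinner_basis_vec_right cinner_commute)

lemma cmod_ell2_nth_le: "cmod (ell2_nth x i) \<le> norm x"
  using cinner_Cauchy_Schwarz[of x "basis_vec i"] by (simp add: cinner_basis_vec_right)

lemma norm_sq_ell2: "(norm x)\<^sup>2 = (\<Sum>\<^sub>\<infinity>i. (cmod (ell2_nth x i))\<^sup>2)"
  by (simp add: norm_ell2_def infsum_nonneg)

text \<open>The truncation cancels exactly the coordinates in \<open>F\<close>, so only the tail of the norm series is left.\<close>

lemma norm_sq_diff_truncation:
  assumes "finite F"
  shows "(norm ((\<Sum>i\<in>F. ell2_nth x i *\<^sub>C basis_vec i) - x))\<^sup>2
    = (norm x)\<^sup>2 - (\<Sum>i\<in>F. (cmod (ell2_nth x i))\<^sup>2)"
proof -
  let ?f = "\<lambda>i. (cmod (ell2_nth x i))\<^sup>2"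
  have coord: "ell2_nth ((\<Sum>i\<in>F. ell2_nth x i *\<^sub>C basis_vec i) - x) j
      = (if j \<in> F then 0 else - ell2_nth x j)" for j
    using assms by (simp add: ell2_nth_sum if_distrib[of "(*) _"] cong: if_cong)
  have "(\<Sum>\<^sub>\<infinity>i. (cmod (if i \<in> F then 0 else - ell2_nth x i))\<^sup>2) = infsum ?f (- F)"
    by (rule infsum_cong_neutral) auto
  moreover have "infsum ?f UNIV = infsum ?f F + infsum ?f (- F)"
    using infsum_Un_disjoint[of ?f F "- F"] assms
      summable_on_subset_banach[OF ell2_nth_summable, of "- F" x]
    by simp
  ultimately show ?thesis
    unfolding norm_sq_ell2 coord using assms by simp
qed

text \<open>By the previous identity the squared error is the error of the partial sums of the norm series,
  which tends to zero.\<close>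

lemma has_sum_basis_expansion: "((\<lambda>i. ell2_nth x i *\<^sub>C basis_vec i) has_sum x) UNIV"
proof -
  let ?s = "sum (\<lambda>i. ell2_nth x i *\<^sub>C basis_vec i)"
  let ?n = "sum (\<lambda>i. (cmod (ell2_nth x i))\<^sup>2)"
  have "(?n \<longlongrightarrow> (norm x)\<^sup>2) (finite_subsets_at_top UNIV)"
    using has_sum_infsum[OF ell2_nth_summable, of x]
    unfolding norm_sq_ell2 has_sum_def .
  then have "((\<lambda>F. sqrt ((norm x)\<^sup>2 - ?n F)) \<longlongrightarrow> sqrt ((norm x)\<^sup>2 - (norm x)\<^sup>2))
      (finite_subsets_at_top UNIV)"
    by (intro tendsto_intros)
  then have "((\<lambda>F. sqrt ((norm x)\<^sup>2 - ?n F)) \<longlongrightarrow> 0) (finite_subsets_at_top UNIV)"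
    by simp
  moreover have "\<forall>\<^sub>F F in finite_subsets_at_top UNIV.
      sqrt ((norm x)\<^sup>2 - ?n F) = norm (?s F - x)"
    by (rule eventually_finite_subsets_at_top_weakI)
      (simp add: norm_sq_diff_truncation[symmetric])
  ultimately have "((\<lambda>F. norm (?s F - x)) \<longlongrightarrow> 0) (finite_subsets_at_top UNIV)"
    by (rule Lim_transform_eventually)
  then show ?thesis
    unfolding has_sum_def by (simp add: tendsto_norm_zero_iff LIM_zero_iff)
qed

lemma op_apply_scaleC_right [simp]: "T \<bullet>\<^sub>v (c *\<^sub>C x) = c *\<^sub>C (T \<bullet>\<^sub>v x)"
  by transfer (simp add: bounded_clinear_def)

text \<open>Linearity alone gives agreement only on finite combinations; boundedness carries both operators
  through the convergent basis expansion.\<close>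

lemma ell2_op_eqI_basis:
  assumes "\<And>i. S \<bullet>\<^sub>v basis_vec i = T \<bullet>\<^sub>v basis_vec i"
  shows "S = T"
proof (rule ell2_op_eqI)
  fix x
  have *: "((\<lambda>i. R \<bullet>\<^sub>v (ell2_nth x i *\<^sub>C basis_vec i)) has_sum (R \<bullet>\<^sub>v x)) UNIV" for R :: "'a ell2_op"
    using has_sum_bounded_linear[OF bounded_linear_op_apply has_sum_basis_expansion]
    by (simp add: o_def)
  show "S \<bullet>\<^sub>v x = T \<bullet>\<^sub>v x"
    using *[of S] *[of T] by (simp add: assms has_sum_unique)
qed

lemma norm_op_apply_le: "norm (T \<bullet>\<^sub>v x) \<le> norm T * norm x"
  unfolding norm_op_eq_onorm by (rule onorm[OF bounded_linear_op_apply])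

lemma norm_op_bound:
  assumes "0 \<le> b" "\<And>x. norm (T \<bullet>\<^sub>v x) \<le> b * norm x"
  shows "norm T \<le> b"
  unfolding norm_op_eq_onorm using assms by (rule onorm_bound)

lemma scaleC_op_mult [simp]:
  fixes S T :: "'i ell2_op"
  shows "(c *\<^sub>C S) * T = c *\<^sub>C (S * T)" "S * (c *\<^sub>C T) = c *\<^sub>C (S * T)"
  by (rule ell2_op_eqI; simp)+

lemma scaleC_zero_left [simp]: "0 *\<^sub>C (x :: 'a::complex_normed_vector) = 0"
  using scaleR_scaleC[of 0 x] by simp

lemma rank_one_mult: "rank_one u v * rank_one w z = cinner w v *\<^sub>C rank_one u z"
  by (rule ell2_op_eqI) (simp add: rank_one_apply cinner_scaleC_left scaleC_scaleC mult.commute)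

section \<open>The Boolean algebra acts irreducibly\<close>

lemma commutes_rank_one_scalar:
  assumes "\<And>u v. T * rank_one u v = rank_one u v * T" and "norm e = 1"
  shows "T = cinner (T \<bullet>\<^sub>v e) e *\<^sub>C 1"
proof (rule ell2_op_eqI)
  fix x
  have "(T * rank_one x e) \<bullet>\<^sub>v e = (rank_one x e * T) \<bullet>\<^sub>v e"
    by (simp only: assms(1))
  then show "T \<bullet>\<^sub>v x = (cinner (T \<bullet>\<^sub>v e) e *\<^sub>C 1) \<bullet>\<^sub>v x"
    using assms(2) by (simp add: rank_one_apply cinner_self)
qed

lemma bicommutant_boolean_algebra: "bicommutant boolean_algebra = UNIV"
proof -
  have rank_one_mem: "rank_one u v \<in> boolean_algebra" for u v
    unfolding boolean_algebra_def
    using compact_rank_one[of u v] by (intro CollectI exI[of _ "rank_one u v"] exI[of _ 0]) simp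
  have "S * T = T * S" if "T \<in> commutant boolean_algebra" for S T
  proof -
    have "T = cinner (T \<bullet>\<^sub>v vacuum) vacuum *\<^sub>C 1"
      using that rank_one_mem unfolding commutant_def
      by (intro commutes_rank_one_scalar) (auto simp: vacuum_def)
    then show ?thesis
      by (metis scaleC_op_mult mult_1_left mult_1_right)
  qed
  then show ?thesis
    unfolding bicommutant_def commutant_def[of "commutant _"] by blast
qed

section \<open>The tail algebra\<close>

lemma annihilator_apply: "annihilator j \<bullet>\<^sub>v x = ell2_nth x (Some j) *\<^sub>C basis_vec None"
  by (simp add: annihilator_def rank_one_apply cinner_basis_vec_right vacuum_def)

lemma vacuum_proj_apply: "vacuum_proj \<bullet>\<^sub>v x = ell2_nth x None *\<^sub>C basis_vec None"
  by (simp add: vacuum_proj_def rank_one_apply cinner_basis_vec_right vacuum_def)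

lemma annihilator_mult_creator: "annihilator k * creator k = vacuum_proj"
  by (simp add: annihilator_def creator_def vacuum_proj_def rank_one_mult cinner_basis_vec_right)

text \<open>By \<open>rank_one_mult\<close> each product of the matrix unit with a generator carries an inner product of
  distinct basis vectors as a factor, so the products in both orders are zero.\<close>

lemma matrix_unit_in_commutant_far_generators:
  assumes "\<bar>i\<bar> \<le> int n" "\<bar>j\<bar> \<le> int n"
  shows "rank_one (basis_vec (Some i)) (basis_vec (Some j))
    \<in> commutant (\<Union>k\<in>{k. \<bar>k\<bar> > int n}. {annihilator k, creator k})"
  using assms unfolding commutant_def
  by (auto simp: annihilator_def creator_def vacuum_def rank_one_mult cinner_basis_vec_right)

lemma tail_algebra_commutes_matrix_unit:
  assumes "T \<in> tail_algebra"
  shows "T * rank_one (basis_vec (Some i)) (basis_vec (Some j))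
    = rank_one (basis_vec (Some i)) (basis_vec (Some j)) * T"
proof -
  define n where "n = nat (max \<bar>i\<bar> \<bar>j\<bar>)"
  have "T \<in> bicommutant (\<Union>k\<in>{k. \<bar>k\<bar> > int n}. {annihilator k, creator k})"
    using assms unfolding tail_algebra_def by blast
  moreover have "rank_one (basis_vec (Some i)) (basis_vec (Some j))
      \<in> commutant (\<Union>k\<in>{k. \<bar>k\<bar> > int n}. {annihilator k, creator k})"
    by (rule matrix_unit_in_commutant_far_generators) (auto simp: n_def)
  ultimately show ?thesis
    unfolding bicommutant_def commutant_def[of "commutant _"] by blast
qed

text \<open>Evaluating the commutation relation with \<open>\<langle>\<cdot>, e\<^sub>j\<rangle> e\<^sub>i\<close> at \<open>x\<close> gives
  \<open>\<langle>x, e\<^sub>j\<rangle> T e\<^sub>i = \<langle>T x, e\<^sub>j\<rangle> e\<^sub>i\<close>. With \<open>x = e\<^sub>j\<close> it makes all \<open>e\<^sub>i\<close>, \<open>i \<in> \<int>\<close>, eigenvectors with the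
  same eigenvalue; with the vacuum as \<open>x\<close> it removes the components of \<open>T e\<^sub>#\<close> off the vacuum.\<close>

lemma tail_algebra_diagonal:
  assumes "T \<in> tail_algebra"
  obtains a b where "T = a *\<^sub>C vacuum_proj + b *\<^sub>C (1 - vacuum_proj)"
proof
  let ?a = "ell2_nth (T \<bullet>\<^sub>v basis_vec None) None"
  let ?b = "ell2_nth (T \<bullet>\<^sub>v basis_vec (Some 0)) (Some 0)"
  have unit: "ell2_nth x (Some j) *\<^sub>C (T \<bullet>\<^sub>v basis_vec (Some i))
      = ell2_nth (T \<bullet>\<^sub>v x) (Some j) *\<^sub>C basis_vec (Some i)" for x i j
    using arg_cong[OF tail_algebra_commutes_matrix_unit[OF assms, of i j], of "\<lambda>S. S \<bullet>\<^sub>v x"]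
    by (simp add: rank_one_apply cinner_basis_vec_right)
  have Some: "T \<bullet>\<^sub>v basis_vec (Some i) = ?b *\<^sub>C basis_vec (Some i)" for i
    using unit[of "basis_vec (Some 0)" 0 i] by simp
  have off: "ell2_nth (T \<bullet>\<^sub>v basis_vec None) (Some j) = 0" for j
    using arg_cong[OF unit[of "basis_vec None" j 0], of "\<lambda>y. ell2_nth y (Some 0)"] by simp
  have None: "T \<bullet>\<^sub>v basis_vec None = ?a *\<^sub>C basis_vec None"
  proof (rule ell2_eqI)
    fix i
    show "ell2_nth (T \<bullet>\<^sub>v basis_vec None) i = ell2_nth (?a *\<^sub>C basis_vec None) i"
      by (cases i) (simp_all add: off)
  qed
  show "T = ?a *\<^sub>C vacuum_proj + ?b *\<^sub>C (1 - vacuum_proj)"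
  proof (rule ell2_op_eqI_basis)
    fix i
    show "T \<bullet>\<^sub>v basis_vec i = (?a *\<^sub>C vacuum_proj + ?b *\<^sub>C (1 - vacuum_proj)) \<bullet>\<^sub>v basis_vec i"
    proof (cases i)
      case None
      then show ?thesis
        using \<open>T \<bullet>\<^sub>v basis_vec None = _\<close> by (simp add: vacuum_proj_apply)
    next
      case (Some k)
      then show ?thesis
        using \<open>\<And>i. T \<bullet>\<^sub>v basis_vec (Some i) = _\<close>[of k] by (simp add: vacuum_proj_apply)
    qed
  qed
qed

text \<open>For each \<open>n\<close> there is some \<open>k > n\<close>, and \<open>P = b\<^sub>k b\<^sub>k\<^sup>\<dagger>\<close> commutes with whatever commutes with
  \<open>b\<^sub>k\<close> and \<open>b\<^sub>k\<^sup>\<dagger>\<close>.\<close>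

lemma vacuum_proj_combination_in_tail_algebra:
  "a *\<^sub>C vacuum_proj + b *\<^sub>C (1 - vacuum_proj) \<in> tail_algebra"
proof -
  have "(a *\<^sub>C vacuum_proj + b *\<^sub>C (1 - vacuum_proj)) * S
      = S * (a *\<^sub>C vacuum_proj + b *\<^sub>C (1 - vacuum_proj))"
    if S: "S \<in> commutant (\<Union>k\<in>{k. \<bar>k\<bar> > int n}. {annihilator k, creator k})" for n S
  proof -
    define k where "k = int n + 1"
    have ann: "S * annihilator k = annihilator k * S" and cre: "S * creator k = creator k * S"
      using S by (auto simp: commutant_def k_def)
    have "S * vacuum_proj = vacuum_proj * S"
      unfolding annihilator_mult_creator[of k, symmetric]
      by (metis ann cre mult.assoc)
    then show ?thesis
      by (simp add: algebra_simps)
  qed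
  then show ?thesis
    unfolding tail_algebra_def bicommutant_def commutant_def[of "commutant _"] by blast
qed

lemma tail_algebra_eq:
  "tail_algebra = {a *\<^sub>C vacuum_proj + b *\<^sub>C (1 - vacuum_proj) | a b. True}"
  using vacuum_proj_combination_in_tail_algebra by (blast elim: tail_algebra_diagonal)

section \<open>Expectations onto the tail algebra kill the annihilators\<close>

text \<open>The quadratic terms in \<open>s\<close> cancel, which leaves \<open>(1 + 2s)r\<^sup>2 \<le> 1\<close>.\<close>

lemma eq_zero_if_linear_growth_bounded:
  fixes r :: real
  assumes "\<And>s. s \<ge> 0 \<Longrightarrow> ((1 + s) * r)\<^sup>2 \<le> 1 + (s * r)\<^sup>2"
  shows "r = 0"
proof (rule ccontr)
  assume "r \<noteq> 0"
  \<comment> \<open>At \<open>s = 1 / r\<^sup>2\<close> the remaining inequality reads \<open>r\<^sup>2 + 2 \<le> 1\<close>.\<close>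
  have "((1 + 1 / r\<^sup>2) * r)\<^sup>2 \<le> 1 + (1 / r\<^sup>2 * r)\<^sup>2"
    by (rule assms) simp
  moreover have "((1 + 1 / r\<^sup>2) * r)\<^sup>2 = r\<^sup>2 + 2 + (1 / r\<^sup>2 * r)\<^sup>2"
    using \<open>r \<noteq> 0\<close> by (simp add: field_simps power2_eq_square)
  ultimately show False
    using zero_le_power2[of r] by linarith
qed

lemma norm_sq_vacuum_split:
  "(norm x)\<^sup>2 = (cmod (ell2_nth x None))\<^sup>2 + (norm ((1 - vacuum_proj) \<bullet>\<^sub>v x))\<^sup>2"
proof -
  have "orthogonal (vacuum_proj \<bullet>\<^sub>v x) ((1 - vacuum_proj) \<bullet>\<^sub>v x)"
    by (simp add: orthogonal_def inner_ell2_def vacuum_proj_apply cinner_scaleC_left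
        cinner_basis_vec_left)
  from norm_add_Pythagorean[OF this] show ?thesis
    by (simp add: vacuum_proj_apply norm_scaleC)
qed

text \<open>Both summands have range \<open>\<complex>e\<^sub>#\<close>, so the sum has rank one and its norm is that of the
  representing vector, whose two components are orthogonal.\<close>

lemma norm_annihilator_add_vacuum_proj:
  "(norm (annihilator j + c *\<^sub>C vacuum_proj))\<^sup>2 \<le> 1 + (cmod c)\<^sup>2"
proof -
  define v where "v = basis_vec (Some j) + cnj c *\<^sub>C basis_vec None"
  have op: "(annihilator j + c *\<^sub>C vacuum_proj) \<bullet>\<^sub>v x = cinner x v *\<^sub>C basis_vec None" for x
  proof -
    have "cinner x v = ell2_nth x (Some j) + c * ell2_nth x None"
      using cinner_commute[of x v]
      by (simp add: v_def cinner_add_left cinner_scaleC_left cinner_basis_vec_left)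
    then show ?thesis
      by (simp add: annihilator_apply vacuum_proj_apply scaleC_add_left scaleC_scaleC)
  qed
  have "norm (annihilator j + c *\<^sub>C vacuum_proj) \<le> norm v"
    by (rule norm_op_bound)
      (simp_all add: op norm_scaleC mult.commute cinner_Cauchy_Schwarz del: op_apply_simps)
  moreover have "(norm v)\<^sup>2 = 1 + (cmod c)\<^sup>2"
    unfolding norm_sq_vacuum_split[of v]
    by (simp add: vacuum_proj_apply) (simp add: v_def)
  ultimately show ?thesis
    by (metis norm_ge_zero power_mono)
qed

text \<open>The two summands have orthogonal ranges, so Pythagoras splits the norm of the image.\<close>

lemma norm_annihilator_add_vacuum_proj_compl:
  "(norm (annihilator j + c *\<^sub>C (1 - vacuum_proj)))\<^sup>2 \<le> 1 + (cmod c)\<^sup>2"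
proof -
  let ?T = "annihilator j + c *\<^sub>C (1 - vacuum_proj)"
  have "norm (?T \<bullet>\<^sub>v x) \<le> sqrt (1 + (cmod c)\<^sup>2) * norm x" for x
  proof -
    let ?y = "(1 - vacuum_proj) \<bullet>\<^sub>v x"
    have None: "ell2_nth (?T \<bullet>\<^sub>v x) None = ell2_nth x (Some j)"
      by (simp add: annihilator_apply vacuum_proj_apply)
    have compl: "(1 - vacuum_proj) \<bullet>\<^sub>v (?T \<bullet>\<^sub>v x) = c *\<^sub>C ?y"
      by (rule ell2_eqI) (simp add: annihilator_apply vacuum_proj_apply)
    have "(norm (?T \<bullet>\<^sub>v x))\<^sup>2 = (cmod (ell2_nth x (Some j)))\<^sup>2 + (cmod c)\<^sup>2 * (norm ?y)\<^sup>2"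
      unfolding norm_sq_vacuum_split[of "?T \<bullet>\<^sub>v x"] None compl
      by (simp only: norm_scaleC power_mult_distrib)
    also have "\<dots> \<le> (norm x)\<^sup>2 + (cmod c)\<^sup>2 * (norm x)\<^sup>2"
    proof (intro add_mono mult_left_mono)
      show "(cmod (ell2_nth x (Some j)))\<^sup>2 \<le> (norm x)\<^sup>2"
        by (intro power_mono cmod_ell2_nth_le) simp
      show "(norm ?y)\<^sup>2 \<le> (norm x)\<^sup>2"
        unfolding norm_sq_vacuum_split[of x] by simp
    qed simp
    also have "\<dots> = (sqrt (1 + (cmod c)\<^sup>2) * norm x)\<^sup>2"
      by (simp add: power_mult_distrib algebra_simps)
    finally show ?thesis
      by (rule power2_le_imp_le) simp
  qed
  then have "norm ?T \<le> sqrt (1 + (cmod c)\<^sup>2)"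
    by (intro norm_op_bound) simp_all
  then have "(norm ?T)\<^sup>2 \<le> (sqrt (1 + (cmod c)\<^sup>2))\<^sup>2"
    by (rule power_mono) simp
  then show ?thesis
    by simp
qed

text \<open>The perturbations \<open>saP\<close> and \<open>sbQ\<close> are fixed by \<open>F\<close>, hence scale the corresponding component of
  the image by \<open>1 + s\<close>; evaluating at a unit vector in the range of \<open>P\<close> or \<open>Q\<close> reads it off.\<close>

lemma expectation_annihilator_eq_zero:
  assumes F: "conditional_expectation_onto tail_algebra F"
  shows "F (annihilator j) = 0"
proof -
  let ?P = vacuum_proj and ?Q = "1 - vacuum_proj"
  have lin: "bounded_linear F" and "onorm F = 1"
    and scale: "\<And>c T. F (c *\<^sub>C T) = c *\<^sub>C F T"
    and idem: "F \<circ> F = F" and range: "range F = tail_algebra"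
    using F by (auto simp: conditional_expectation_onto_def bounded_clinear_def)
  have contr: "norm (F T) \<le> norm T" for T
    using onorm[OF lin, of T] \<open>onorm F = 1\<close> by simp
  have fixed: "F T = T" if "T \<in> tail_algebra" for T
    using that idem unfolding range[symmetric] by (auto simp: fun_eq_iff)
  have add: "F (S + T) = F S + F T" for S T
    using lin by (simp add: bounded_linear.linear linear_add)
  have mem: "c *\<^sub>C ?P \<in> tail_algebra" "c *\<^sub>C ?Q \<in> tail_algebra" for c
    using vacuum_proj_combination_in_tail_algebra[of c 0]
      vacuum_proj_combination_in_tail_algebra[of 0 c] by simp_all
  have "F (annihilator j) \<in> tail_algebra"
    using range by blast
  then obtain a b where ab: "F (annihilator j) = a *\<^sub>C ?P + b *\<^sub>C ?Q"
    by (rule tail_algebra_diagonal)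
  have "cmod a = 0"
  proof (rule eq_zero_if_linear_growth_bounded)
    fix s :: real assume "s \<ge> 0"
    let ?T = "annihilator j + (of_real s * a) *\<^sub>C ?P"
    have "F ?T \<bullet>\<^sub>v basis_vec None = (of_real (1 + s) * a) *\<^sub>C basis_vec None"
      by (rule ell2_eqI) (simp add: add fixed mem ab vacuum_proj_apply algebra_simps)
    then have "(1 + s) * cmod a = norm (F ?T \<bullet>\<^sub>v basis_vec None)"
      using \<open>s \<ge> 0\<close> by (simp add: norm_scaleC norm_mult del: of_real_add)
    also have "\<dots> \<le> norm ?T"
      using norm_op_apply_le[of "F ?T" "basis_vec None"] contr[of ?T] by simp
    finally have "((1 + s) * cmod a)\<^sup>2 \<le> (norm ?T)\<^sup>2"
      using \<open>s \<ge> 0\<close> by (intro power_mono) simp_all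
    also have "\<dots> \<le> 1 + (s * cmod a)\<^sup>2"
      using norm_annihilator_add_vacuum_proj[of j "of_real s * a"] \<open>s \<ge> 0\<close>
      by (simp add: norm_mult)
    finally show "((1 + s) * cmod a)\<^sup>2 \<le> 1 + (s * cmod a)\<^sup>2" .
  qed
  moreover have "cmod b = 0"
  proof (rule eq_zero_if_linear_growth_bounded)
    fix s :: real assume "s \<ge> 0"
    let ?e = "basis_vec (Some j)"
    let ?T = "annihilator j + (of_real s * b) *\<^sub>C ?Q"
    have "F ?T \<bullet>\<^sub>v ?e = (of_real (1 + s) * b) *\<^sub>C ?e"
      by (rule ell2_eqI) (simp add: add fixed mem ab vacuum_proj_apply algebra_simps)
    then have "(1 + s) * cmod b = norm (F ?T \<bullet>\<^sub>v ?e)"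
      using \<open>s \<ge> 0\<close> by (simp add: norm_scaleC norm_mult del: of_real_add)
    also have "\<dots> \<le> norm ?T"
      using norm_op_apply_le[of "F ?T" ?e] contr[of ?T] by simp
    finally have "((1 + s) * cmod b)\<^sup>2 \<le> (norm ?T)\<^sup>2"
      using \<open>s \<ge> 0\<close> by (intro power_mono) simp_all
    also have "\<dots> \<le> 1 + (s * cmod b)\<^sup>2"
      using norm_annihilator_add_vacuum_proj_compl[of j "of_real s * b"] \<open>s \<ge> 0\<close>
      by (simp add: norm_mult)
    finally show "((1 + s) * cmod b)\<^sup>2 \<le> 1 + (s * cmod b)\<^sup>2" .
  qed
  ultimately show ?thesis
    by (simp add: ab)
qed

lemma no_state_preserving_expectation:
  assumes "norm \<xi> = 1" "0 < cmod (cinner vacuum \<xi>)" "cmod (cinner vacuum \<xi>) < 1"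
    and F: "conditional_expectation_onto tail_algebra F"
  shows "\<not> preserves_state (vector_state \<xi>) F"
proof
  assume pres: "preserves_state (vector_state \<xi>) F"
  have vac: "cinner vacuum \<xi> = cnj (ell2_nth \<xi> None)"
    by (simp add: vacuum_def cinner_basis_vec_left)
  have "\<exists>j. ell2_nth \<xi> (Some j) \<noteq> 0"
  proof (rule ccontr)
    assume none: "\<nexists>j. ell2_nth \<xi> (Some j) \<noteq> 0"
    have "\<xi> = ell2_nth \<xi> None *\<^sub>C basis_vec None"
    proof (rule ell2_eqI)
      fix i
      show "ell2_nth \<xi> i = ell2_nth (ell2_nth \<xi> None *\<^sub>C basis_vec None) i"
        using none by (cases i) simp_all
    qed
    then have "norm \<xi> = cmod (ell2_nth \<xi> None)"
      by (metis norm_scaleC norm_basis_vec mult.right_neutral)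
    with assms vac show False
      by simp
  qed
  then obtain j where j: "ell2_nth \<xi> (Some j) \<noteq> 0" ..
  have "vector_state \<xi> (annihilator j) = vector_state \<xi> (F (annihilator j))"
    using pres by (metis preserves_state_def comp_apply)
  also have "\<dots> = 0"
    using cinner_scaleC_left[of 0 \<xi> \<xi>]
    by (simp add: expectation_annihilator_eq_zero[OF F] vector_state_def)
  finally have "ell2_nth \<xi> (Some j) * cinner vacuum \<xi> = 0"
    by (simp add: vector_state_def annihilator_apply cinner_scaleC_left vacuum_def)
  with j assms(2) show False
    by simp
qed

theorem mainTheorem9:
  fixes \<xi> :: boolean_fock
  assumes "norm \<xi> = 1"
  shows "bicommutant boolean_algebra = UNIV
    \<and> tail_algebra = {a *\<^sub>C vacuum_proj + b *\<^sub>C (1 - vacuum_proj) | a b. True}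
    \<and> (0 < cmod (cinner vacuum \<xi>) \<and> cmod (cinner vacuum \<xi>) < 1 \<longrightarrow>
        \<not> (\<exists>F. conditional_expectation_onto tail_algebra F \<and> preserves_state (vector_state \<xi>) F))"
  using bicommutant_boolean_algebra tail_algebra_eq no_state_preserving_expectation[OF assms]
  by blast

end
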